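(* Let $m$ be an even integer such that $q=2m^2+2m+1$ is a prime power. Let $\omega$ be a primitive element of $\mathbb{F}_{q^2}$, $C_i^{(4,q^2)}=\omega^i\langle\omega^4\rangle$ (indices mod 4), $\chi_4$ the multiplicative character of $\mathbb{F}_{q^2}$ with $\chi_4(\omega)=\zeta_4=i$, and $\eta$ the quadratic character of $\mathbb{F}_q$. Let $\epsilon,\delta\in\{1,-1\}$ be such that $G_q(\eta)G_{q^2}(\chi_4)/q=\epsilon(m+1)+\delta m\zeta_4$. Let $h\in\{0,1,2,3\}$ and let $\ell$ be an integer not divisible by $q+1$ with \[ \chi_4(\omega^\ell)=\zeta_4^{3+h},\qquad \chi_4(\omega^{\ell q}-\omega^\ell)=\zeta_4^{\delta(1+2h)}. \] Set $(H_0,H_1)=(\{h,h+1\},\{h+1,h+2\})$ if $\epsilon\delta=1$ and $(H_0,H_1)=(\{h+1,h+2\},\{h,h+1\})$ if $\epsilon\delta=-1$ (indices mod 4), and $D_{\ell,H_d}=\{x\in\mathbb{F}_q: 1+x\omega^\ell\in\bigcup_{j\in H_d}C_j^{(4,q^2)}\}$ for $d=0,1$. Then $|D_{\ell,H_0}|=m^2$, $|D_{\ell,H_1}|=m^2+m+1$, \[ \{|D_{\ell,H_0}\cap((C_0^{(2,q)}\cup\{0\})+s)|+|D_{\ell,H_1}\cap(C_0^{(2,q)}+s)|: s\in\mathbb{F}_q\}=\{m^2,m^2+1,m^2+m+1,m^2+m+2\}, \] and \[ \{|D_{\ell,H_0}\cap(C_0^{(2,q)}+s)|+|D_{\ell,H_1}\cap((\mathbb{F}_q^*\setminus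 C_0^{(2,q)})+s)|: s\in\mathbb{F}_q\}=\{m^2,m^2+m\}, \] where $C_0^{(2,q)}$ is the set of nonzero squares of $\mathbb{F}_q$.
   Context: For a prime power $Q=p^f$, the canonical additive character of $\mathbb{F}_Q$ is $\psi_{\mathbb{F}_Q}(x)=\exp(2\pi i\,\mathrm{Tr}_{Q/p}(x)/p)$, and for a multiplicative character $\chi$ of $\mathbb{F}_Q$ the Gauss sum is $G_Q(\chi)=\sum_{x\in\mathbb{F}_Q^*}\chi(x)\psi_{\mathbb{F}_Q}(x)$. For $m$ even, signs $\epsilon,\delta$ as in the claim exist.
   Formalization: The case m = -2 (q = 5) is excluded: there the class of x with 1+xω^ℓ in C_{h+3} is empty, so the first set of sums is {3,4} rather than the claimed {3,4,5}; all other even m are covered. *)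

theory Defs
  imports Complex_Main "HOL-Computational_Algebra.Primes" "HOL-Number_Theory.Prime_Powers"
begin

(* The field with q^2 elements is a type 'a :: finite_field, and the field with q elements is a
   subset of it. *)
definition is_subfield :: "'a :: field set \<Rightarrow> bool" where
  "is_subfield K \<longleftrightarrow> 0 \<in> K \<and> 1 \<in> K \<and>
     (\<forall>x\<in>K. \<forall>y\<in>K. x + y \<in> K \<and> x * y \<in> K) \<and> (\<forall>x\<in>K. - x \<in> K \<and> inverse x \<in> K)"

definition primitive_element :: "'a :: field \<Rightarrow> bool" where
  "primitive_element w \<longleftrightarrow> w \<noteq> 0 \<and> (\<forall>x. x \<noteq> 0 \<longrightarrow> (\<exists>n::nat. x = w ^ n))"

(* For a finite field of order Q and primitive w, with N dividing Q - 1, this depends only on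
   i modulo N. *)
definition cyclotomic_class :: "'a :: field \<Rightarrow> nat \<Rightarrow> int \<Rightarrow> 'a set" where
  "cyclotomic_class w N i = {w powi i * (w ^ N) powi k | k :: int. True}"

definition nonzero_squares :: "'a :: field set \<Rightarrow> 'a set" where
  "nonzero_squares K = {x\<^sup>2 | x. x \<in> K - {0}}"

(* Values outside K - {0} are irrelevant. *)
definition is_mult_character :: "'a :: field set \<Rightarrow> ('a \<Rightarrow> complex) \<Rightarrow> bool" where
  "is_mult_character K \<chi> \<longleftrightarrow> (\<forall>x\<in>K - {0}. \<chi> x \<noteq> 0) \<and>
     (\<forall>x\<in>K - {0}. \<forall>y\<in>K - {0}. \<chi> (x * y) = \<chi> x * \<chi> y)"

definition quadratic_character :: "'a :: field set \<Rightarrow> 'a \<Rightarrow> complex" where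
  "quadratic_character K x =
     (if x = 0 then 0 else if x \<in> nonzero_squares K then 1 else - 1)"

definition prime_field_degree :: "'a :: finite_field set \<Rightarrow> nat" where
  "prime_field_degree K = (THE f. card K = CHAR('a) ^ f)"

definition absolute_trace :: "'a :: finite_field set \<Rightarrow> 'a \<Rightarrow> 'a" where
  "absolute_trace K x = (\<Sum>i<prime_field_degree K. x ^ (CHAR('a) ^ i))"

definition prime_field_lift :: "'a :: finite_field \<Rightarrow> nat" where
  "prime_field_lift x = (THE n. n < CHAR('a) \<and> of_nat n = x)"

definition canonical_additive_character :: "'a :: finite_field set \<Rightarrow> 'a \<Rightarrow> complex" where
  "canonical_additive_character K x =
     exp (2 * of_real pi * \<i> * of_nat (prime_field_lift (absolute_trace K x)) / of_nat CHAR('a))"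

definition gauss_sum :: "'a :: finite_field set \<Rightarrow> ('a \<Rightarrow> complex) \<Rightarrow> complex" where
  "gauss_sum K \<chi> = (\<Sum>x\<in>K - {0}. \<chi> x * canonical_additive_character K x)"

definition D_set :: "'a :: field set \<Rightarrow> 'a \<Rightarrow> int \<Rightarrow> int set \<Rightarrow> 'a set" where
  "D_set K w l H = {x \<in> K. 1 + x * w powi l \<in> (\<Union>j\<in>H. cyclotomic_class w 4 j)}"

definition translate :: "'a :: field set \<Rightarrow> 'a \<Rightarrow> 'a set" where
  "translate A s = (\<lambda>x. x + s) ` A"

end

theory Submission
  imports Defs "HOL-Computational_Algebra.Polynomial" "HOL-Number_Theory.Residues"
begin

text \<open>
  Write \<open>b = \<omega>\<^sup>l\<close> and let \<open>\<chi>\<close> be the quartic character, whose restriction to \<open>F\<^sub>q\<close> is the quadratic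
  character \<open>\<eta>\<close> since \<open>q \<equiv> 1 (mod 4)\<close>. Every nonzero element is a nonzero scalar times a unique
  \<open>1 + x b\<close> or \<open>b\<close>. Splitting the Gauss sum over the quadratic extension accordingly, and writing
  linear functionals as \<open>y \<mapsto> Tr (c y)\<close>, evaluates \<open>\<Sum>\<^sub>x \<chi> (1 + x b)\<close> and \<open>\<Sum>\<^sub>x \<chi> (1 + x b) \<eta> (x - s)\<close> in terms
  of \<open>E = G\<^sub>q(\<eta>) G(\<chi>) / q\<close>. The indicator function of a union of two consecutive quartic classes is
  affine in the real and imaginary parts of \<open>\<chi>\<close>, so these sums determine all cardinalities, the
  intersection sizes depending only on the class of \<open>1 + s b\<close>. The sum of \<open>\<chi>\<^sup>2\<close> gives the sizes of the
  individual classes on the line, which are positive for \<open>m \<notin> {0, - 2}\<close>.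
\<close>

section \<open>The subfield as the fixed points of the q-th power map, and traces\<close>

text \<open>Degree bound for the nonzero polynomial \<open>X^n - X\<close>. With
  \<open>n = q\<close> and \<open>n = CHAR('a)\<close> it shows that \<open>K\<close> and the prime
  field exhaust the roots they are contained in.\<close>

lemma card_roots_power_eq_self:
  assumes "n > 1"
  shows "card {x :: 'a :: finite_field. x ^ n = x} \<le> n"
proof -
  define P :: "'a poly" where "P = Polynomial.monom 1 n - Polynomial.monom 1 1"
  have "Polynomial.coeff P n = 1" using assms by (simp add: P_def)
  hence "P \<noteq> 0" by auto
  moreover have "Polynomial.degree P \<le> n"
    unfolding P_def using assms
    by (intro degree_diff_le) (auto intro: order_trans[OF degree_monom_le])
  moreover have "{x. poly P x = 0} = {x. x ^ n = x}"
    by (auto simp: P_def poly_monom)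
  ultimately show ?thesis
    using card_poly_roots_bound[of P] by simp
qed

locale quadratic_extension =
  fixes q :: nat and K :: "'a :: finite_field set"
  assumes primepow_q: "primepow q"
    and card_field: "card (UNIV :: 'a set) = q\<^sup>2"
    and subfield: "is_subfield K"
    and card_K: "card K = q"
begin

lemma K_closed [simp]:
  "0 \<in> K" "1 \<in> K"
  "x \<in> K \<Longrightarrow> y \<in> K \<Longrightarrow> x + y \<in> K"
  "x \<in> K \<Longrightarrow> y \<in> K \<Longrightarrow> x * y \<in> K"
  "x \<in> K \<Longrightarrow> - x \<in> K"
  "x \<in> K \<Longrightarrow> inverse x \<in> K"
  using subfield by (auto simp: is_subfield_def)

lemma K_diff [simp]: "x \<in> K \<Longrightarrow> y \<in> K \<Longrightarrow> x - y \<in> K"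
  using K_closed(3)[of x "- y"] by simp

lemma K_divide [simp]: "x \<in> K \<Longrightarrow> y \<in> K \<Longrightarrow> x / y \<in> K"
  using K_closed(4)[of x "inverse y"] by (simp add: divide_inverse)

lemma K_power: "x \<in> K \<Longrightarrow> x ^ n \<in> K"
  by (induction n) auto

lemma q_gt_1: "q > 1"
  using primepow_gt_Suc_0[OF primepow_q] by simp

text \<open>Multiplication by a nonzero \<open>x\<close> permutes the nonzero elements of
  \<open>K\<close>; cancelling their product leaves \<open>x ^ (q - 1) = 1\<close>.\<close>

lemma power_card_K:
  assumes "x \<in> K" shows "x ^ q = x"
proof (cases "x = 0")
  case False
  have "(\<Prod>y\<in>K-{0}. x * y) = (\<Prod>y\<in>K-{0}. y)"
    by (rule prod.reindex_bij_witness[of _ "\<lambda>y. y / x" "\<lambda>y. x * y"]) (use False assms in auto)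
  hence "x ^ card (K - {0}) * \<Prod>(K-{0}) = \<Prod>(K-{0})"
    by (simp add: prod.distrib)
  hence "x ^ (q - 1) = 1"
    by (simp add: card_K)
  hence "x * x ^ (q - 1) = x" by simp
  thus ?thesis using q_gt_1 by (simp flip: power_Suc)
qed (use q_gt_1 in auto)

lemma mem_K_iff: "x \<in> K \<longleftrightarrow> x ^ q = x"
proof -
  have "K = {x. x ^ q = x}"
    by (rule card_seteq) (use power_card_K card_roots_power_eq_self[OF q_gt_1, where ?'a='a] card_K in auto)
  thus ?thesis by auto
qed

text \<open>The prime below \<open>q\<close> is the characteristic because the characteristic
  divides the order of the field. The degree is a definite description, so uniqueness of the
  exponent has to be shown both for \<open>K\<close> and for the whole field.\<close>

lemma q_eq_CHAR_power: "q = CHAR('a) ^ prime_field_degree K"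
  and prime_field_degree_UNIV: "prime_field_degree (UNIV :: 'a set) = 2 * prime_field_degree K"
proof -
  obtain p k where pk: "prime p" "k > 0" "q = p ^ k"
    using primepow_q by (auto simp: primepow_def)
  have "CHAR('a) dvd p ^ (k * 2)"
    using CHAR_dvd_CARD[where ?'a='a] by (simp add: card_field pk power_mult)
  hence "CHAR('a) dvd p"
    using prime_dvd_power CHAR_prime by blast
  hence p: "p = CHAR('a)" using pk(1) CHAR_prime primes_dvd_imp_eq by metis
  have gt: "CHAR('a) > 1" using CHAR_prime prime_gt_1_nat by blast
  have k: "prime_field_degree K = k"
    unfolding prime_field_degree_def
    by (rule the_equality) (use gt in \<open>auto simp: card_K pk p\<close>)
  thus "q = CHAR('a) ^ prime_field_degree K" by (simp add: pk p)
  have "card (UNIV :: 'a set) = CHAR('a) ^ (2 * k)"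
    by (simp add: card_field pk p mult.commute flip: power_mult)
  hence "prime_field_degree (UNIV :: 'a set) = 2 * k"
    unfolding prime_field_degree_def
    by (intro the_equality) (use gt in \<open>auto simp: power_inject_exp\<close>)
  thus "prime_field_degree (UNIV :: 'a set) = 2 * prime_field_degree K" by (simp add: k)
qed

lemma power_q_add: "(x + y :: 'a) ^ q = x ^ q + y ^ q"
  using freshmans_dream'[OF CHAR_prime q_eq_CHAR_power] .

lemma power_q_minus: "(- x :: 'a) ^ q = - (x ^ q)"
  using power_q_add[of x "- x"] q_gt_1 by (simp add: eq_neg_iff_add_eq_0 power_0_left add.commute)

lemma power_q_diff: "(x - y :: 'a) ^ q = x ^ q - y ^ q"
  using power_q_add[of x "- y"] by (simp add: power_q_minus)

lemma power_q_q: "((x :: 'a) ^ q) ^ q = x"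
  using finite_field_power_card_eq_same[of x] by (simp add: card_field power2_eq_square power_mult)

definition rel_trace :: "'a \<Rightarrow> 'a" where
  "rel_trace x = x + x ^ q"

lemma rel_trace_mem_K [simp]: "rel_trace x \<in> K"
  by (simp add: mem_K_iff rel_trace_def power_q_add power_q_q add.commute)

lemma rel_trace_mult: "c \<in> K \<Longrightarrow> rel_trace (c * x) = c * rel_trace x"
  by (simp add: rel_trace_def power_mult_distrib power_card_K algebra_simps)

lemma rel_trace_add: "rel_trace (x + y) = rel_trace x + rel_trace y"
  by (simp add: rel_trace_def power_q_add)

text \<open>Transitivity of the trace: of the \<open>2 f\<close> conjugates of \<open>x\<close>, the
  second half are the first \<open>f\<close> conjugates of \<open>x ^ q\<close>.\<close>

lemma absolute_trace_UNIV: "absolute_trace UNIV x = absolute_trace K (rel_trace x)"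
proof -
  let ?f = "prime_field_degree K" and ?p = "CHAR('a)"
  have split: "(\<Sum>i<n + k. g i) = (\<Sum>i<n. g i) + (\<Sum>i<k. g (n + i))" for g :: "nat \<Rightarrow> 'a" and n k
    by (induction k) (simp_all add: add.assoc)
  have "absolute_trace UNIV x = (\<Sum>i<?f. x ^ (?p ^ i)) + (\<Sum>i<?f. x ^ (?p ^ (?f + i)))"
    unfolding absolute_trace_def prime_field_degree_UNIV mult_2 split[of "\<lambda>i. x ^ (?p ^ i)"] ..
  also have "(\<Sum>i<?f. x ^ (?p ^ (?f + i))) = (\<Sum>i<?f. (x ^ q) ^ (?p ^ i))"
    by (subst q_eq_CHAR_power) (simp add: power_add flip: power_mult)
  finally show ?thesis
    by (simp add: absolute_trace_def rel_trace_def sum.distrib freshmans_dream'[OF CHAR_prime refl])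
qed

lemma absolute_trace_K_add: "absolute_trace K (x + y) = absolute_trace K x + absolute_trace K y"
  by (simp add: absolute_trace_def sum.distrib freshmans_dream'[OF CHAR_prime refl])

text \<open>Frobenius shifts the summands cyclically, and \<open>x ^ q = x\<close> closes the cycle.
  This places the trace in the prime field, where \<open>prime_field_lift\<close> is
  meaningful.\<close>

lemma absolute_trace_K_frobenius:
  assumes "x \<in> K" shows "absolute_trace K x ^ CHAR('a) = absolute_trace K x"
proof -
  let ?f = "prime_field_degree K" and ?p = "CHAR('a)"
  have "absolute_trace K x ^ ?p = (\<Sum>i<?f. x ^ (?p ^ Suc i))"
    by (simp add: absolute_trace_def freshmans_dream_sum[OF CHAR_prime refl] mult.commute flip: power_mult)
  also have "\<dots> + x ^ (?p ^ 0) = (\<Sum>i<Suc ?f. x ^ (?p ^ i))"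
    by (subst sum.lessThan_Suc_shift) (simp add: add.commute)
  also have "\<dots> = absolute_trace K x + x ^ q"
    by (simp add: absolute_trace_def flip: q_eq_CHAR_power)
  finally show ?thesis using power_card_K[OF assms] by simp
qed

end

section \<open>Additivity and orthogonality of the canonical additive character\<close>

lemma of_nat_eq_of_nat_iff_CHAR:
  "m < CHAR('a) \<Longrightarrow> n < CHAR('a) \<Longrightarrow> (of_nat m :: 'a :: finite_field) = of_nat n \<longleftrightarrow> m = n"
proof (induction m n rule: linorder_wlog)
  case (le m n)
  show ?case
  proof (cases "m = n")
    case False
    hence "m < n" using le by simp
    from of_nat_eq_iff_char_dvd[OF this, where ?'a='a] show ?thesis
      using \<open>m < n\<close> le nat_dvd_not_less[of "n - m" "CHAR('a)"] by auto
  qed simp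
qed auto

text \<open>The residues below the characteristic \<open>p\<close> give \<open>p\<close> distinct
  roots of \<open>x ^ p = x\<close>, hence all of them.\<close>

lemma prime_field_lift_correct:
  fixes t :: "'a :: finite_field"
  assumes "t ^ CHAR('a) = t"
  shows "prime_field_lift t < CHAR('a) \<and> of_nat (prime_field_lift t) = t"
proof -
  have gt: "CHAR('a) > 1" using CHAR_prime prime_gt_1_nat by blast
  have pw: "of_nat n ^ CHAR('a) = (of_nat n :: 'a)" for n
    by (induction n) (use gt in \<open>simp_all add: freshmans_dream[OF CHAR_prime refl]\<close>)
  have inj: "inj_on (of_nat :: nat \<Rightarrow> 'a) {..<CHAR('a)}"
    by (auto simp: inj_on_def of_nat_eq_of_nat_iff_CHAR)
  have "of_nat ` {..<CHAR('a)} = {x :: 'a. x ^ CHAR('a) = x}"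
    by (rule card_seteq)
       (use card_roots_power_eq_self[OF gt, where ?'a='a] pw in \<open>auto simp: card_image inj\<close>)
  hence "t \<in> of_nat ` {..<CHAR('a)}" using assms by simp
  then obtain n where n: "n < CHAR('a)" "of_nat n = t" by auto
  hence "prime_field_lift t = n"
    unfolding prime_field_lift_def
    by (intro the_equality) (auto simp flip: of_nat_eq_of_nat_iff_CHAR[where ?'a='a])
  thus ?thesis using n by simp
qed

text \<open>Lifts add modulo the characteristic, and a multiple of the characteristic changes the
  exponent by a multiple of the period \<open>2 \<pi> \<i>\<close>.\<close>

lemma exp_prime_field_lift_add:
  fixes s t :: "'a :: finite_field"
  assumes "s ^ CHAR('a) = s" "t ^ CHAR('a) = t"
  shows "exp (2 * of_real pi * \<i> * of_nat (prime_field_lift (s + t)) / of_nat CHAR('a)) =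
    exp (2 * of_real pi * \<i> * of_nat (prime_field_lift s) / of_nat CHAR('a)) *
    exp (2 * of_real pi * \<i> * of_nat (prime_field_lift t) / of_nat CHAR('a))"
proof -
  define a b c where "a = prime_field_lift s" "b = prime_field_lift t" "c = prime_field_lift (s + t)"
  have st: "(s + t) ^ CHAR('a) = s + t"
    using assms by (simp add: freshmans_dream[OF CHAR_prime refl])
  have "of_nat c = (of_nat (a + b) :: 'a)"
    using assms st by (simp add: a_b_c_def prime_field_lift_correct)
  moreover have "of_nat (a + b) = (of_nat ((a + b) mod CHAR('a)) :: 'a)"
    by (metis (no_types, lifting) add.right_neutral mod_mult_div_eq mult_zero_left of_nat_CHAR of_nat_add of_nat_mult)
  ultimately have "c = (a + b) mod CHAR('a)"
    using of_nat_eq_of_nat_iff_CHAR[of c "(a + b) mod CHAR('a)", where ?'a='a]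
      prime_field_lift_correct[OF st] by (simp add: a_b_c_def)
  then obtain k where k: "a + b = c + CHAR('a) * k"
    by (metis mod_mult_div_eq)
  have "exp (2 * of_real pi * \<i> * of_nat a / of_nat CHAR('a)) *
      exp (2 * of_real pi * \<i> * of_nat b / of_nat CHAR('a)) =
      exp (2 * of_real pi * \<i> * of_nat (a + b) / of_nat CHAR('a))"
    by (simp add: exp_add[symmetric] add_divide_distrib ring_distribs)
  also have "2 * of_real pi * \<i> * of_nat (a + b) / of_nat CHAR('a) =
      2 * of_real pi * \<i> * of_nat c / of_nat CHAR('a) + of_nat k * (2 * of_real pi * \<i>)"
    unfolding k by (simp add: field_simps)
  also have "exp \<dots> = exp (2 * of_real pi * \<i> * of_nat c / of_nat CHAR('a))"
    by (simp add: exp_add exp_of_nat_mult)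
  finally show ?thesis by (simp add: a_b_c_def)
qed

context quadratic_extension
begin

abbreviation \<psi> :: "'a \<Rightarrow> complex" where "\<psi> \<equiv> canonical_additive_character K"
abbreviation \<eta> :: "'a \<Rightarrow> complex" where "\<eta> \<equiv> quadratic_character K"

lemma psi_add: "x \<in> K \<Longrightarrow> y \<in> K \<Longrightarrow> \<psi> (x + y) = \<psi> x * \<psi> y"
  unfolding canonical_additive_character_def absolute_trace_K_add
  by (intro exp_prime_field_lift_add absolute_trace_K_frobenius)

lemma psi_UNIV: "canonical_additive_character UNIV x = \<psi> (rel_trace x)"
  by (simp add: canonical_additive_character_def absolute_trace_UNIV)

lemma psi_0: "\<psi> 0 = 1"
proof -
  have "\<psi> 0 \<noteq> 0" by (simp add: canonical_additive_character_def)
  thus ?thesis using psi_add[of 0 0] by simp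
qed

lemma sum_psi:
  assumes "a \<in> K" "\<psi> a \<noteq> 1"
  shows "(\<Sum>x\<in>K. \<psi> x) = 0"
proof -
  have "(\<Sum>x\<in>K. \<psi> x) = (\<Sum>x\<in>K. \<psi> (a + x))"
    by (rule sum.reindex_bij_witness[of _ "\<lambda>x. a + x" "\<lambda>x. x - a"]) (use assms in auto)
  also have "\<dots> = \<psi> a * (\<Sum>x\<in>K. \<psi> x)"
    using assms by (simp add: psi_add sum_distrib_left)
  finally show ?thesis using assms by simp
qed

text \<open>The element \<open>a\<close> witnesses that \<open>\<psi>\<close> is nontrivial; later
  it is obtained from a nonzero Gauss sum.\<close>

lemma sum_psi_mult:
  assumes "a \<in> K" "\<psi> a \<noteq> 1" "c \<in> K"
  shows "(\<Sum>x\<in>K-{0}. \<psi> (c * x)) = (if c = 0 then of_nat q else 0) - 1"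
proof (cases "c = 0")
  case True
  thus ?thesis using q_gt_1 by (simp add: psi_0 card_K of_nat_diff)
next
  case False
  have "(\<Sum>x\<in>K-{0}. \<psi> (c * x)) = (\<Sum>x\<in>K. \<psi> (c * x)) - 1"
    by (simp add: sum_diff1 psi_0)
  also have "(\<Sum>x\<in>K. \<psi> (c * x)) = (\<Sum>x\<in>K. \<psi> x)"
    by (rule sum.reindex_bij_witness[of _ "\<lambda>x. x / c" "\<lambda>x. c * x"]) (use assms False in auto)
  finally show ?thesis using False sum_psi[OF assms(1,2)] by simp
qed

end

section \<open>The quartic character and its restriction to the subfield\<close>

lemma imaginary_unit_power_mod_4: "\<i> ^ n = \<i> ^ (n mod 4)"
proof -
  have "\<i> ^ n = \<i> ^ (n mod 4 + 4 * (n div 4))" by simp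
  thus ?thesis by (simp only: power_add power_mult) (simp add: power4_eq_xxxx)
qed

lemma imaginary_unit_power_eq_iff: "\<i> ^ m = \<i> ^ n \<longleftrightarrow> m mod 4 = n mod 4"
proof
  assume *: "\<i> ^ m = \<i> ^ n"
  have "m mod 4 \<in> {0,1,2,3}" "n mod 4 \<in> {0,1,2,3}" by auto
  with * show "m mod 4 = n mod 4"
    by (subst (asm) imaginary_unit_power_mod_4[of m], subst (asm) imaginary_unit_power_mod_4[of n])
       (auto simp: power3_eq_cube complex_eq_iff)
qed (metis imaginary_unit_power_mod_4)

text \<open>The congruence on \<open>q\<close> makes \<open>\<chi>\<close> invariant under the
  conjugation \<open>x \<mapsto> x ^ q\<close> and makes its restriction to \<open>K\<close>
  quadratic.\<close>

locale quartic_character = quadratic_extension +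
  fixes \<omega> :: 'a and \<chi> :: "'a \<Rightarrow> complex"
  assumes q_mod_4: "q mod 4 = 1"
    and primitive: "primitive_element \<omega>"
    and mult_char: "is_mult_character UNIV \<chi>"
    and chi_omega: "\<chi> \<omega> = \<i>"
begin

lemma omega_nonzero [simp]: "\<omega> \<noteq> 0"
  using primitive by (simp add: primitive_element_def)

lemma omega_power_ex: "x \<noteq> 0 \<Longrightarrow> \<exists>n. x = \<omega> ^ n"
  using primitive by (simp add: primitive_element_def)

lemma chi_mult: "x \<noteq> 0 \<Longrightarrow> y \<noteq> 0 \<Longrightarrow> \<chi> (x * y) = \<chi> x * \<chi> y"
  using mult_char by (auto simp: is_mult_character_def)

lemma chi_nonzero: "x \<noteq> 0 \<Longrightarrow> \<chi> x \<noteq> 0"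
  using mult_char by (auto simp: is_mult_character_def)

lemma chi_1: "\<chi> 1 = 1"
  using chi_mult[of 1 1] chi_nonzero[of 1] by simp

lemma chi_power: "x \<noteq> 0 \<Longrightarrow> \<chi> (x ^ n) = \<chi> x ^ n"
  by (induction n) (simp_all add: chi_1 chi_mult)

lemma chi_omega_power: "\<chi> (\<omega> ^ n) = \<i> ^ n"
  by (simp add: chi_power chi_omega)

lemma chi_inverse: "x \<noteq> 0 \<Longrightarrow> \<chi> (inverse x) = inverse (\<chi> x)"
  using chi_mult[of x "inverse x"] by (simp add: chi_1 inverse_unique)

lemma chi_divide: "x \<noteq> 0 \<Longrightarrow> y \<noteq> 0 \<Longrightarrow> \<chi> (x / y) = \<chi> x / \<chi> y"
  by (simp add: divide_inverse chi_mult chi_inverse)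

lemma chi_powi: "x \<noteq> 0 \<Longrightarrow> \<chi> (x powi n) = \<chi> x powi n"
  by (cases n) (auto simp: power_int_def chi_power chi_inverse)

lemma chi_power_4: "x \<noteq> 0 \<Longrightarrow> \<chi> x ^ 4 = 1"
proof -
  assume "x \<noteq> 0"
  then obtain n where "x = \<omega> ^ n" using omega_power_ex by blast
  hence "\<chi> x ^ 4 = \<i> ^ (n * 4)" by (simp add: chi_omega_power power_mult)
  thus ?thesis by (subst (asm) imaginary_unit_power_mod_4) simp
qed

lemma chi_power_q: "x \<noteq> 0 \<Longrightarrow> \<chi> (x ^ q) = \<chi> x"
proof -
  assume x: "x \<noteq> 0"
  have "q = 4 * (q div 4) + 1" using q_mod_4 by presburger
  hence "\<chi> x ^ q = (\<chi> x ^ 4) ^ (q div 4) * \<chi> x" by (metis power_add power_mult power_one_right)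
  thus ?thesis using x by (simp add: chi_power chi_power_4)
qed

text \<open>If \<open>\<omega> ^ k = 1\<close> with \<open>k > 0\<close>, the first \<open>k\<close>
  powers already cover all \<open>q^2 - 1\<close> nonzero elements, so \<open>k\<close> cannot be
  smaller than that. Applied to the remainder of \<open>n\<close>, this forces the remainder to be
  0.\<close>

lemma omega_power_eq_1_imp:
  assumes "\<omega> ^ n = 1" shows "(q\<^sup>2 - 1) dvd n"
proof -
  define N where "N = q\<^sup>2 - 1"
  have N: "N > 0" "Suc N = q\<^sup>2" using q_gt_1 by (auto simp: N_def power2_eq_square one_less_mult)
  have "\<omega> * \<omega> ^ N = \<omega>"
    using finite_field_power_card_eq_same[of \<omega>] by (simp add: card_field flip: N(2))
  hence one: "\<omega> ^ N = 1" by simp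
  have le: "N \<le> k" if "k > 0" "\<omega> ^ k = 1" for k
  proof -
    have "UNIV - {0} \<subseteq> (\<lambda>i. \<omega> ^ i) ` {..<k}"
    proof
      fix x :: 'a assume "x \<in> UNIV - {0}"
      then obtain j where "x = \<omega> ^ j" using omega_power_ex by blast
      also have "\<omega> ^ j = \<omega> ^ (j mod k)"
        by (metis mod_mult_div_eq mult.right_neutral power_add power_mult power_one that(2))
      finally show "x \<in> (\<lambda>i. \<omega> ^ i) ` {..<k}" using that(1) by auto
    qed
    hence "card (UNIV - {0 :: 'a}) \<le> card ((\<lambda>i. \<omega> ^ i) ` {..<k})"
      by (intro card_mono) auto
    also have "\<dots> \<le> k" using card_image_le[of "{..<k}"] by simp
    finally show ?thesis by (simp add: card_Diff_singleton card_field N_def)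
  qed
  have "\<omega> ^ (n mod N) = 1"
    by (metis assms mod_mult_div_eq mult.right_neutral one power_add power_mult power_one)
  moreover have "n mod N < N" using N by simp
  ultimately have "n mod N = 0" using le[of "n mod N"] by (cases "n mod N = 0") auto
  thus ?thesis by (simp add: N_def mod_eq_0_iff_dvd)
qed

lemma q_square_minus_1: "q\<^sup>2 - 1 = (q + 1) * (q - 1)"
  by (simp add: power2_eq_square algebra_simps diff_mult_distrib)

text \<open>Being fixed by the q-th power means \<open>\<omega> ^ (n * (q - 1)) = 1\<close>, and
  \<open>q - 1\<close> cancels from the resulting divisibility. Conversely,
  \<open>\<omega> ^ (q + 1)\<close> is the norm of \<open>\<omega>\<close>, which conjugation
  fixes.\<close>

lemma omega_power_mem_K: "\<omega> ^ n \<in> K \<longleftrightarrow> (q + 1) dvd n"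
proof
  assume "\<omega> ^ n \<in> K"
  hence "\<omega> ^ n * (\<omega> ^ n) ^ (q - 1) = \<omega> ^ n"
    using q_gt_1 by (simp add: mem_K_iff flip: power_Suc)
  hence "\<omega> ^ (n * (q - 1)) = 1" by (simp add: power_mult)
  hence "(q + 1) * (q - 1) dvd n * (q - 1)"
    using omega_power_eq_1_imp unfolding q_square_minus_1 by blast
  moreover have "q - 1 \<noteq> 0" using q_gt_1 by simp
  ultimately show "(q + 1) dvd n" using dvd_times_right_cancel_iff by blast
next
  assume "(q + 1) dvd n"
  then obtain k where k: "n = (q + 1) * k" by auto
  have "(\<omega> ^ (q + 1)) ^ q = \<omega> ^ q * (\<omega> ^ q) ^ q"
    by (simp add: power_add mult.commute power_mult_distrib)
  also have "\<dots> = \<omega> ^ (q + 1)" by (simp add: power_q_q)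
  finally have "\<omega> ^ (q + 1) \<in> K" unfolding mem_K_iff .
  thus "\<omega> ^ n \<in> K" unfolding k power_mult by (rule K_power)
qed

lemma nonzero_K_omega_power:
  assumes "x \<in> K" "x \<noteq> 0"
  obtains k where "x = \<omega> ^ ((q + 1) * k)" "\<chi> x = (-1) ^ k"
proof -
  obtain n where n: "x = \<omega> ^ n" using omega_power_ex assms by blast
  then obtain k where k: "n = (q + 1) * k" using assms omega_power_mem_K by auto
  have "(q + 1) mod 4 = 2 mod 4" using q_mod_4 by presburger
  hence "\<i> ^ (q + 1) = \<i> ^ 2" using imaginary_unit_power_eq_iff by blast
  moreover have "\<chi> x = (\<i> ^ (q + 1)) ^ k" unfolding n k using chi_omega_power power_mult by metis
  ultimately have "\<chi> x = (-1) ^ k" by simp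
  with that n k show thesis by blast
qed

text \<open>The generator \<open>\<omega> ^ (q + 1)\<close> of the nonzero elements of
  \<open>K\<close> has \<open>\<chi>\<close>-value \<open>\<i> ^ (q + 1) = -1\<close>, so both
  characters read off the parity of the same exponent.\<close>

lemma eta_eq_chi:
  assumes "x \<in> K" "x \<noteq> 0" shows "\<eta> x = \<chi> x"
proof -
  obtain k where k: "x = \<omega> ^ ((q + 1) * k)" "\<chi> x = (-1) ^ k"
    using nonzero_K_omega_power assms by blast
  have "x \<in> nonzero_squares K \<longleftrightarrow> even k"
  proof
    assume "x \<in> nonzero_squares K"
    then obtain y where y: "x = y\<^sup>2" "y \<in> K" "y \<noteq> 0" by (auto simp: nonzero_squares_def)
    then obtain j where "y = \<omega> ^ ((q + 1) * j)" "\<chi> y = (-1) ^ j"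
      using nonzero_K_omega_power by blast
    hence "\<chi> x = ((-1) ^ j)\<^sup>2" using chi_power[OF y(3), of 2] y(1) by metis
    hence "\<chi> x = 1" by (simp flip: power_mult)
    with k show "even k" by (cases "even k") auto
  next
    assume "even k"
    then obtain j where "k = j * 2" by (metis dvdE mult.commute)
    hence "x = (\<omega> ^ ((q + 1) * j))\<^sup>2" using k by (simp flip: power_mult add: mult.assoc)
    moreover have "\<omega> ^ ((q + 1) * j) \<in> K" by (simp only: omega_power_mem_K dvd_triv_left)
    ultimately show "x \<in> nonzero_squares K" unfolding nonzero_squares_def by force
  qed
  thus ?thesis using k assms by (auto simp: quadratic_character_def)
qed

text \<open>Since 8 divides \<open>q^2 - 1\<close>, the element -1 is a fourth power.\<close>

lemma chi_minus_1: "\<chi> (-1) = 1"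
proof -
  obtain n where n: "-1 = \<omega> ^ n" using omega_power_ex[of "-1"] by auto
  hence "\<omega> ^ (n * 2) = 1" by (simp add: power_mult flip: n)
  hence "(q\<^sup>2 - 1) dvd n * 2" by (rule omega_power_eq_1_imp)
  moreover have "8 dvd q\<^sup>2 - 1"
  proof -
    have "4 dvd q - 1" "2 dvd q + 1" using q_mod_4 by presburger+
    hence "2 * 4 dvd (q + 1) * (q - 1)" by (rule mult_dvd_mono[rotated])
    thus ?thesis unfolding q_square_minus_1 by simp
  qed
  ultimately have "8 dvd n * 2" by (rule dvd_trans[rotated])
  hence "n mod 4 = 0 mod 4" by presburger
  hence "\<i> ^ n = \<i> ^ 0" using imaginary_unit_power_eq_iff by blast
  thus ?thesis by (simp add: n chi_omega_power)
qed

section \<open>Sums of the quadratic character and its Gauss sum\<close>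

lemma eta_0 [simp]: "\<eta> 0 = 0"
  by (simp add: quadratic_character_def)

lemma eta_mult: "x \<in> K \<Longrightarrow> y \<in> K \<Longrightarrow> \<eta> (x * y) = \<eta> x * \<eta> y"
  by (cases "x = 0 \<or> y = 0") (auto simp: eta_eq_chi chi_mult)

lemma eta_eq_1_or_minus_1: "x \<noteq> 0 \<Longrightarrow> \<eta> x = 1 \<or> \<eta> x = -1"
  by (simp add: quadratic_character_def)

lemma eta_square: "x \<noteq> 0 \<Longrightarrow> \<eta> x * \<eta> x = 1"
  using eta_eq_1_or_minus_1[of x] by auto

lemma sum_eta_nonzero: "(\<Sum>x\<in>K-{0}. \<eta> x) = 0"
proof -
  let ?a = "\<omega> ^ (q + 1)"
  have a: "?a \<in> K" "?a \<noteq> 0" using omega_power_mem_K[of "q + 1"] by auto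
  have "(q + 1) mod 4 = 2 mod 4" using q_mod_4 by presburger
  hence "\<i> ^ (q + 1) = \<i> ^ 2" using imaginary_unit_power_eq_iff by blast
  hence eta_a: "\<eta> ?a = -1"
    unfolding eta_eq_chi[OF a] chi_omega_power by simp
  have "(\<Sum>x\<in>K-{0}. \<eta> x) = (\<Sum>x\<in>K-{0}. \<eta> (?a * x))"
    by (rule sum.reindex_bij_witness[of _ "\<lambda>x. ?a * x" "\<lambda>x. x / ?a"]) (use a in auto)
  also have "\<dots> = - (\<Sum>x\<in>K-{0}. \<eta> x)"
    using a eta_a by (simp add: eta_mult sum_negf del: power_Suc)
  finally show ?thesis by simp
qed

lemma sum_eta: "(\<Sum>x\<in>K. \<eta> x) = 0"
  using sum_eta_nonzero by (simp add: sum_diff1)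

lemma sum_eta_shift: "s \<in> K \<Longrightarrow> (\<Sum>x\<in>K. \<eta> (x - s)) = 0"
  using sum.reindex_bij_witness[of K "\<lambda>x. x + s" "\<lambda>x. x - s" K "\<eta>" "\<lambda>x. \<eta> (x - s)"] sum_eta
  by auto

text \<open>Substituting \<open>x * c\<close> for \<open>x\<close> costs a factor
  \<open>\<eta> c\<close>. At \<open>c = 0\<close> the convention \<open>\<eta> 0 = 0\<close> agrees
  with the vanishing of the sum of \<open>\<eta>\<close>.\<close>

lemma sum_eta_psi_mult:
  assumes "c \<in> K"
  shows "(\<Sum>x\<in>K-{0}. \<eta> x * \<psi> (x * c)) = \<eta> c * gauss_sum K \<eta>"
proof (cases "c = 0")
  case True
  thus ?thesis using sum_eta_nonzero by (simp add: psi_0)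
next
  case False
  have "gauss_sum K \<eta> = (\<Sum>x\<in>K-{0}. \<eta> (x * c) * \<psi> (x * c))"
    unfolding gauss_sum_def
    by (rule sum.reindex_bij_witness[of _ "\<lambda>x. x * c" "\<lambda>x. x / c"]) (use assms False in auto)
  also have "\<dots> = \<eta> c * (\<Sum>x\<in>K-{0}. \<eta> x * \<psi> (x * c))"
    using assms by (simp add: eta_mult sum_distrib_left mult_ac)
  finally show ?thesis using eta_square[OF False] by (simp add: mult.assoc[symmetric])
qed

text \<open>
  Hence the nontriviality of the canonical character needs no separate proof: by hypothesis the Gauss
  sum is a factor of the nonzero number \<open>\<epsilon> (m + 1) + \<delta> m \<i>\<close>.
\<close>
lemma gauss_sum_nonzero_imp_psi_nontrivial:
  assumes "gauss_sum K \<eta> \<noteq> 0"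
  obtains a where "a \<in> K" "\<psi> a \<noteq> 1"
proof (cases "\<forall>x\<in>K. \<psi> x = 1")
  case True
  hence "gauss_sum K \<eta> = (\<Sum>x\<in>K-{0}. \<eta> x)" by (simp add: gauss_sum_def)
  thus thesis using assms sum_eta_nonzero by simp
next
  case False
  thus thesis using that by blast
qed

text \<open>Absorbing \<open>\<eta> y\<close> into one Gauss sum turns the square into a double sum
  over \<open>\<psi> ((x + 1) * y)\<close>; orthogonality in \<open>y\<close> singles out
  \<open>x = -1\<close>. The usual sign \<open>\<eta> (-1)\<close> is 1 here.\<close>

lemma gauss_sum_eta_square:
  assumes "gauss_sum K \<eta> \<noteq> 0"
  shows "gauss_sum K \<eta> * gauss_sum K \<eta> = of_nat q"
proof -
  obtain a where a: "a \<in> K" "\<psi> a \<noteq> 1"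
    by (rule gauss_sum_nonzero_imp_psi_nontrivial[OF assms])
  let ?S = "K - {0}"
  have "gauss_sum K \<eta> * gauss_sum K \<eta> = (\<Sum>y\<in>?S. \<psi> y * (\<eta> y * gauss_sum K \<eta>))"
    by (simp add: gauss_sum_def[of K \<eta>] sum_distrib_right mult_ac)
  also have "\<dots> = (\<Sum>y\<in>?S. \<psi> y * (\<Sum>x\<in>?S. \<eta> x * \<psi> (x * y)))"
    by (intro sum.cong) (auto simp: sum_eta_psi_mult)
  also have "\<dots> = (\<Sum>y\<in>?S. \<Sum>x\<in>?S. \<eta> x * \<psi> ((x + 1) * y))"
    by (simp add: sum_distrib_left psi_add ring_distribs mult_ac)
  also have "\<dots> = (\<Sum>x\<in>?S. \<eta> x * (\<Sum>y\<in>?S. \<psi> ((x + 1) * y)))"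
    by (subst sum.swap) (simp add: sum_distrib_left)
  also have "\<dots> = (\<Sum>x\<in>?S. \<eta> x * ((if x = -1 then of_nat q else 0) - 1))"
    by (intro sum.cong) (auto simp: sum_psi_mult[OF a] eq_neg_iff_add_eq_0)
  also have "\<dots> = (\<Sum>x\<in>?S. (if x = -1 then \<eta> x * of_nat q else 0)) - (\<Sum>x\<in>?S. \<eta> x)"
    by (subst sum_subtractf[symmetric]) (intro sum.cong, auto simp: algebra_simps)
  also have "\<dots> = \<eta> (-1) * of_nat q"
    by (simp add: sum_eta_nonzero)
  also have "\<eta> (-1) = 1" using eta_eq_chi[of "-1"] chi_minus_1 by simp
  finally show ?thesis by simp
qed

end

section \<open>Splitting the quadratic extension along an affine line; character sums over
  \<open>1 + x * b\<close>\<close>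

text \<open>For \<open>b\<close> outside \<open>K\<close>, the elements 1 and \<open>b\<close> form
  a basis over \<open>K\<close>. In the application \<open>b = \<omega> powi l\<close>, with
  \<open>q + 1\<close> not dividing \<open>l\<close>.\<close>

locale quartic_character_line = quartic_character +
  fixes b :: 'a
  assumes b_notin_K: "b \<notin> K"
begin

lemma b_nonzero [simp]: "b \<noteq> 0"
  using b_notin_K by auto

lemma linear_comb_eq_iff:
  assumes "s \<in> K" "t \<in> K" "s' \<in> K" "t' \<in> K"
  shows "s + t * b = s' + t' * b \<longleftrightarrow> s = s' \<and> t = t'"
proof
  assume eq: "s + t * b = s' + t' * b"
  have "t = t'"
  proof (rule ccontr)
    assume "t \<noteq> t'"
    hence "b = (s - s') / (t' - t)" using eq by (simp add: field_simps)
    thus False using b_notin_K assms by auto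
  qed
  thus "s = s' \<and> t = t'" using eq by simp
qed auto

text \<open>An injective map from \<open>q * q\<close> pairs into a field with \<open>q^2\<close>
  elements is onto.\<close>

lemma linear_comb_exhaust:
  obtains s t where "s \<in> K" "t \<in> K" "z = s + t * b"
proof -
  have inj: "inj_on (\<lambda>(s, t). s + t * b) (K \<times> K)"
    by (auto simp: inj_on_def linear_comb_eq_iff)
  have "(\<lambda>(s, t). s + t * b) ` (K \<times> K) = UNIV"
    by (rule card_subset_eq) (auto simp: card_image[OF inj] card_cartesian_product card_K card_field power2_eq_square)
  hence "z \<in> (\<lambda>(s, t). s + t * b) ` (K \<times> K)" by simp
  thus thesis using that by auto
qed

lemma line_nonzero: "x \<in> K \<Longrightarrow> 1 + x * b \<noteq> 0"
  using linear_comb_eq_iff[of 1 x 0 0] by auto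

text \<open>The elements \<open>1 + x * b\<close> and \<open>b\<close> represent the
  \<open>q + 1\<close> points of the projective line over \<open>K\<close>, with \<open>b\<close> as
  the point at infinity.\<close>

lemma sum_nonzero_projective:
  fixes f :: "'a \<Rightarrow> complex"
  shows "(\<Sum>z\<in>UNIV-{0}. f z) =
    (\<Sum>x\<in>K. \<Sum>t\<in>K-{0}. f (t * (1 + x * b))) + (\<Sum>t\<in>K-{0}. f (t * b))"
proof -
  let ?g = "\<lambda>(x, t). t * (1 + x * b)"
  let ?A = "?g ` (K \<times> (K - {0}))" and ?B = "(\<lambda>t. t * b) ` (K - {0})"
  have inj: "inj_on ?g (K \<times> (K - {0}))"
  proof (rule inj_onI)
    fix u v assume uv: "u \<in> K \<times> (K - {0})" "v \<in> K \<times> (K - {0})" "?g u = ?g v"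
    obtain x t x' t' where *: "u = (x, t)" "v = (x', t')" by (metis surj_pair)
    have "t + (t * x) * b = t' + (t' * x') * b" using uv * by (simp add: algebra_simps)
    thus "u = v" using uv * by (subst (asm) linear_comb_eq_iff) auto
  qed
  have "UNIV - {0} = ?A \<union> ?B"
  proof (intro equalityI subsetI)
    fix z :: 'a assume z: "z \<in> UNIV - {0}"
    obtain s t where st: "s \<in> K" "t \<in> K" "z = s + t * b" by (rule linear_comb_exhaust)
    show "z \<in> ?A \<union> ?B"
    proof (cases "s = 0")
      case True
      thus ?thesis using st z by auto
    next
      case False
      hence "z = ?g (t / s, s)" using st by (simp add: field_simps)
      moreover have "(t / s, s) \<in> K \<times> (K - {0})" using st False by auto
      ultimately show ?thesis by blast
    qed
  qed (use line_nonzero in auto)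
  moreover have "?A \<inter> ?B = {}"
  proof (rule ccontr)
    assume "?A \<inter> ?B \<noteq> {}"
    then obtain x t t' where *: "x \<in> K" "t \<in> K" "t \<noteq> 0" "t' \<in> K" "t * (1 + x * b) = t' * b"
      by auto
    hence "t + (t * x) * b = 0 + t' * b" by (simp add: algebra_simps)
    thus False using * by (subst (asm) linear_comb_eq_iff) auto
  qed
  ultimately have "(\<Sum>z\<in>UNIV-{0}. f z) = sum f ?A + sum f ?B"
    by (simp add: sum.union_disjoint)
  also have "sum f ?A = (\<Sum>x\<in>K. \<Sum>t\<in>K-{0}. f (t * (1 + x * b)))"
    unfolding sum.reindex[OF inj] sum.cartesian_product by (simp add: case_prod_unfold)
  also have "sum f ?B = (\<Sum>t\<in>K-{0}. f (t * b))"
    by (subst sum.reindex) (auto simp: inj_on_def)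
  finally show ?thesis .
qed

text \<open>On each line through the origin the sum over scalars \<open>t\<close> is a twisted
  quadratic Gauss sum, because \<open>\<chi> t = \<eta> t\<close>. The free parameter
  \<open>c\<close> is the point: it ranges over all nonzero linear functionals
  \<open>z \<mapsto> rel_trace (c * z)\<close>.\<close>

lemma gauss_sum_UNIV_eq:
  assumes "c \<noteq> 0"
  shows "gauss_sum UNIV \<chi> = \<chi> c * gauss_sum K \<eta> *
    ((\<Sum>x\<in>K. \<chi> (1 + x * b) * \<eta> (rel_trace (c * (1 + x * b)))) + \<chi> b * \<eta> (rel_trace (c * b)))"
proof -
  define f where "f z = \<chi> z * \<psi> (rel_trace (c * z))" for z
  have inner: "(\<Sum>t\<in>K-{0}. f (t * u)) = \<chi> u * \<eta> (rel_trace (c * u)) * gauss_sum K \<eta>" if "u \<noteq> 0" for u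
  proof -
    have "(\<Sum>t\<in>K-{0}. f (t * u)) = (\<Sum>t\<in>K-{0}. \<chi> u * (\<eta> t * \<psi> (t * rel_trace (c * u))))"
    proof (rule sum.cong)
      fix t assume "t \<in> K - {0}"
      thus "f (t * u) = \<chi> u * (\<eta> t * \<psi> (t * rel_trace (c * u)))"
        using that rel_trace_mult[of t "c * u"] by (simp add: f_def chi_mult eta_eq_chi mult_ac)
    qed simp
    thus ?thesis by (simp add: sum_eta_psi_mult flip: sum_distrib_left)
  qed
  have "gauss_sum UNIV \<chi> = (\<Sum>z\<in>UNIV-{0}. \<chi> (c * z) * \<psi> (rel_trace (c * z)))"
    unfolding gauss_sum_def psi_UNIV
    by (rule sum.reindex_bij_witness[of _ "\<lambda>x. c * x" "\<lambda>x. x / c"]) (use assms in auto)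
  also have "\<dots> = \<chi> c * (\<Sum>z\<in>UNIV-{0}. f z)"
    using assms by (simp add: chi_mult f_def sum_distrib_left mult_ac)
  also have "(\<Sum>z\<in>UNIV-{0}. f z) = gauss_sum K \<eta> *
    ((\<Sum>x\<in>K. \<chi> (1 + x * b) * \<eta> (rel_trace (c * (1 + x * b)))) + \<chi> b * \<eta> (rel_trace (c * b)))"
  proof -
    have "(\<Sum>x\<in>K. \<Sum>t\<in>K-{0}. f (t * (1 + x * b))) =
        (\<Sum>x\<in>K. \<chi> (1 + x * b) * \<eta> (rel_trace (c * (1 + x * b))) * gauss_sum K \<eta>)"
      by (intro sum.cong refl inner line_nonzero)
    thus ?thesis unfolding sum_nonzero_projective inner[OF b_nonzero]
      by (simp only: sum_distrib_right[symmetric] distrib_right[symmetric] mult.commute[of "gauss_sum K \<eta>"])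
  qed
  finally show ?thesis by (simp add: mult_ac)
qed

text \<open>Since \<open>gauss_sum K \<eta>\<close> squares to \<open>q\<close> by
  \<open>gauss_sum_eta_square\<close>, this is the quotient of the Gauss sum of
  \<open>\<chi>\<close> by that of its restriction, an Eisenstein sum.\<close>

definition eisenstein :: complex where
  "eisenstein = gauss_sum K \<eta> * gauss_sum UNIV \<chi> / of_nat q"

lemma eisenstein_eq:
  assumes "c \<noteq> 0" "eisenstein \<noteq> 0"
  shows "(\<Sum>x\<in>K. \<chi> (1 + x * b) * \<eta> (rel_trace (c * (1 + x * b)))) =
    eisenstein / \<chi> c - \<chi> b * \<eta> (rel_trace (c * b))"
proof -
  let ?T = "(\<Sum>x\<in>K. \<chi> (1 + x * b) * \<eta> (rel_trace (c * (1 + x * b)))) + \<chi> b * \<eta> (rel_trace (c * b))"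
  have "gauss_sum K \<eta> \<noteq> 0" using assms by (auto simp: eisenstein_def)
  hence sq: "gauss_sum K \<eta> * gauss_sum K \<eta> = of_nat q" by (rule gauss_sum_eta_square)
  have "eisenstein = (gauss_sum K \<eta> * gauss_sum K \<eta>) * \<chi> c * ?T / of_nat q"
    unfolding eisenstein_def gauss_sum_UNIV_eq[OF assms(1)] by (simp add: mult_ac)
  also have "\<dots> = \<chi> c * ?T" using q_gt_1 by (simp add: sq)
  finally show ?thesis using chi_nonzero[OF assms(1)] by (simp add: field_simps)
qed

lemma conj_diff_nonzero: "b ^ q - b \<noteq> 0"
  using b_notin_K by (simp add: mem_K_iff)

lemma rel_trace_functional:
  assumes "x \<in> K"
  shows "rel_trace (c * (1 + x * b)) = rel_trace c + x * rel_trace (c * b)"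
proof -
  have "c * (1 + x * b) = c + x * (c * b)" by (simp add: algebra_simps)
  thus ?thesis using assms by (simp add: rel_trace_add rel_trace_mult)
qed

lemma sum_chi_line:
  assumes "eisenstein \<noteq> 0"
  shows "(\<Sum>x\<in>K. \<chi> (1 + x * b)) = \<chi> (b ^ q - b) / \<chi> b * eisenstein"
proof -
  \<comment> \<open>Dual basis: this \<open>c\<close> gives the functional with value 1 at 1 and 0
    at \<open>b\<close>. It is constantly 1 on the line and kills the term at infinity. The
    conjugate of \<open>c\<close> uses that \<open>b ^ q - b\<close> changes sign under
    conjugation.\<close>
  define c where "c = b ^ q / (b ^ q - b)"
  have c: "c \<noteq> 0" using conj_diff_nonzero by (simp add: c_def)
  have cq: "c ^ q = - b / (b ^ q - b)"
    by (simp add: c_def power_divide power_q_diff power_q_q)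
       (metis minus_diff_eq minus_divide_divide minus_divide_left)
  have 1: "rel_trace c = 1"
    using conj_diff_nonzero unfolding rel_trace_def cq by (simp add: c_def flip: diff_divide_distrib)
  have 2: "rel_trace (c * b) = 0"
    using conj_diff_nonzero unfolding rel_trace_def power_mult_distrib cq by (simp add: c_def)
  have 3: "\<chi> c = \<chi> b / \<chi> (b ^ q - b)"
    using conj_diff_nonzero unfolding c_def by (subst chi_divide) (auto simp: chi_power_q)
  have 4: "\<eta> 1 = 1" by (simp add: eta_eq_chi chi_1)
  have "(\<Sum>x\<in>K. \<chi> (1 + x * b)) = (\<Sum>x\<in>K. \<chi> (1 + x * b) * \<eta> (rel_trace (c * (1 + x * b))))"
    by (intro sum.cong) (auto simp: rel_trace_functional 1 2 4)
  also have "\<dots> = eisenstein / \<chi> c" by (simp add: eisenstein_eq[OF c assms] 2)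
  finally show ?thesis by (simp add: 3)
qed

lemma sum_chi_eta_line:
  assumes "eisenstein \<noteq> 0" and s: "s \<in> K"
  shows "(\<Sum>x\<in>K. \<chi> (1 + x * b) * \<eta> (x - s)) =
    \<chi> (b ^ q - b) * eisenstein / \<chi> (1 + s * b) - \<chi> b"
proof -
  define D where "D = b ^ q - b"
  have D: "D \<noteq> 0" using conj_diff_nonzero by (simp add: D_def)
  have Dq: "D ^ q = - D" by (simp add: D_def power_q_diff power_q_q)
  \<comment> \<open>As \<open>D ^ q = - D\<close>, a multiple of \<open>(1 + s * b) ^ q / D\<close>
    gives a functional vanishing at \<open>1 + s * b\<close>. The sign normalises it to 1 at
    \<open>b\<close>, so on the line it equals \<open>x - s\<close>.\<close>
  define c where "c = - ((1 + s * b) ^ q / D)"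
  have c: "c \<noteq> 0" using D line_nonzero[OF s] by (simp add: c_def)
  have pq: "(1 + s * b) ^ q = 1 + s * b ^ q"
    by (simp add: power_q_add power_mult_distrib power_card_K[OF s])
  have cq: "c ^ q = (1 + s * b) / D"
    by (simp add: c_def power_q_minus power_divide Dq power_q_q)
  have c': "c = - ((1 + s * b ^ q) / D)" unfolding c_def pq ..
  have 1: "rel_trace c = - s"
    using D unfolding rel_trace_def cq by (simp add: c' field_simps) (simp add: D_def algebra_simps)
  have 2: "rel_trace (c * b) = 1"
    using D unfolding rel_trace_def power_mult_distrib cq by (simp add: c' field_simps) (simp add: D_def algebra_simps)
  have 3: "\<chi> c = \<chi> (1 + s * b) / \<chi> D"
  proof -
    have "c = (-1) * ((1 + s * b) ^ q / D)" by (simp add: c_def)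
    also have "\<chi> \<dots> = \<chi> (1 + s * b) / \<chi> D"
      using D line_nonzero[OF s]
      by (subst chi_mult) (auto simp: chi_minus_1 chi_divide chi_power_q)
    finally show ?thesis .
  qed
  have 4: "\<eta> 1 = 1" by (simp add: eta_eq_chi chi_1)
  have "(\<Sum>x\<in>K. \<chi> (1 + x * b) * \<eta> (x - s)) = (\<Sum>x\<in>K. \<chi> (1 + x * b) * \<eta> (rel_trace (c * (1 + x * b))))"
    by (intro sum.cong) (auto simp: rel_trace_functional 1 2)
  also have "\<dots> = eisenstein / \<chi> c - \<chi> b" by (simp add: eisenstein_eq[OF c assms(1)] 2 4)
  finally show ?thesis by (simp add: 3 D_def mult.commute)
qed

text \<open>The square of \<open>\<chi>\<close> is trivial on \<open>K\<close>, so each point of the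
  projective line contributes its value \<open>q - 1\<close> times. The total over the field
  vanishes because \<open>\<chi> \<omega>\<close> squares to -1.\<close>

lemma sum_chi_square_line: "(\<Sum>x\<in>K. (\<chi> (1 + x * b))\<^sup>2) = - (\<chi> b)\<^sup>2"
proof -
  have sq: "(\<chi> t)\<^sup>2 = 1" if "t \<in> K - {0}" for t
    using that eta_square[of t] by (simp add: eta_eq_chi power2_eq_square)
  have inner: "(\<Sum>t\<in>K-{0}. (\<chi> (t * u))\<^sup>2) = of_nat (q - 1) * (\<chi> u)\<^sup>2" if "u \<noteq> 0" for u
  proof -
    have "(\<Sum>t\<in>K-{0}. (\<chi> (t * u))\<^sup>2) = (\<Sum>t\<in>K-{0}. (\<chi> u)\<^sup>2)"
      by (intro sum.cong) (use that sq in \<open>auto simp: chi_mult power_mult_distrib\<close>)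
    thus ?thesis by (simp add: card_K)
  qed
  have "(\<Sum>z\<in>UNIV-{0}. (\<chi> z)\<^sup>2) = (\<Sum>z\<in>UNIV-{0}. (\<chi> (\<omega> * z))\<^sup>2)"
    by (rule sum.reindex_bij_witness[of _ "\<lambda>x. \<omega> * x" "\<lambda>x. x / \<omega>"]) auto
  also have "\<dots> = - (\<Sum>z\<in>UNIV-{0}. (\<chi> z)\<^sup>2)"
    by (simp add: chi_mult chi_omega power_mult_distrib sum_negf)
  finally have "(\<Sum>z\<in>UNIV-{0}. (\<chi> z)\<^sup>2) = 0" by simp
  moreover have "(\<Sum>x\<in>K. \<Sum>t\<in>K-{0}. (\<chi> (t * (1 + x * b)))\<^sup>2) =
      (\<Sum>x\<in>K. of_nat (q - 1) * (\<chi> (1 + x * b))\<^sup>2)"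
    by (intro sum.cong refl inner line_nonzero)
  ultimately have "of_nat (q - 1) * ((\<Sum>x\<in>K. (\<chi> (1 + x * b))\<^sup>2) + (\<chi> b)\<^sup>2) = 0"
    unfolding sum_nonzero_projective inner[OF b_nonzero]
    by (simp only: sum_distrib_left[symmetric] distrib_left[symmetric])
  thus ?thesis using q_gt_1 by (simp add: eq_neg_iff_add_eq_0 del: of_nat_diff)
qed

end

section \<open>From character sums to intersection sizes\<close>

context quadratic_extension
begin

lemma mem_translate: "x \<in> translate A s \<longleftrightarrow> x - s \<in> (A :: 'a set)"
  unfolding translate_def by (metis (no_types, lifting) add_diff_cancel diff_add_cancel imageE imageI)

lemma zero_notin_nonzero_squares: "0 \<notin> nonzero_squares K"
  by (auto simp: nonzero_squares_def)

text \<open>The coefficient \<open>r\<close> selects squares or nonsquares. At \<open>x = s\<close>,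
  where \<open>\<eta>\<close> vanishes, \<open>r'\<close> decides whether the point is counted;
  without it the point would count as one half.\<close>

lemma double_card_inter:
  assumes "\<And>x. x \<in> X \<Longrightarrow> 2 * of_bool (x \<in> T) = 1 + r * Re (\<eta> (x - s)) + r' * of_bool (x = s)"
  shows "2 * real (card (X \<inter> T)) = card X + r * (\<Sum>x\<in>X. Re (\<eta> (x - s))) + r' * of_bool (s \<in> X)"
proof -
  have "2 * real (card (X \<inter> T)) = (\<Sum>x\<in>X. 2 * of_bool (x \<in> T))"
    by (simp flip: sum_distrib_left)
  also have "\<dots> = (\<Sum>x\<in>X. 1 + r * Re (\<eta> (x - s)) + r' * of_bool (x = s))"
    by (rule sum.cong[OF refl assms])
  also have "\<dots> = card X + r * (\<Sum>x\<in>X. Re (\<eta> (x - s))) + r' * (\<Sum>x\<in>X. of_bool (x = s))"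
    by (simp add: sum.distrib sum_distrib_left del: sum_of_bool_eq)
  also have "(\<Sum>x\<in>X. of_bool (x = s)) = (of_bool (s \<in> X) :: real)"
    by (simp add: of_bool_def)
  finally show ?thesis .
qed

lemma double_card_inter_squares:
  "2 * real (card (X \<inter> translate (nonzero_squares K) s)) =
    card X + (\<Sum>x\<in>X. Re (\<eta> (x - s))) - of_bool (s \<in> X)"
  using double_card_inter[of X "translate (nonzero_squares K) s" 1 s "-1"]
  by (auto simp: mem_translate quadratic_character_def zero_notin_nonzero_squares)

lemma double_card_inter_squares_0:
  "2 * real (card (X \<inter> translate (nonzero_squares K \<union> {0}) s)) =
    card X + (\<Sum>x\<in>X. Re (\<eta> (x - s))) + of_bool (s \<in> X)"
  using double_card_inter[of X "translate (nonzero_squares K \<union> {0}) s" 1 s 1]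
  by (auto simp: mem_translate quadratic_character_def)

lemma double_card_inter_nonsquares:
  assumes "X \<subseteq> K" "s \<in> K"
  shows "2 * real (card (X \<inter> translate ((K - {0}) - nonzero_squares K) s)) =
    card X - (\<Sum>x\<in>X. Re (\<eta> (x - s))) - of_bool (s \<in> X)"
proof -
  have "2 * of_bool (x \<in> translate ((K - {0}) - nonzero_squares K) s) =
      1 + (- 1) * Re (\<eta> (x - s)) + (- 1) * of_bool (x = s)" if "x \<in> X" for x
    using that assms
    by (auto simp: mem_translate quadratic_character_def zero_notin_nonzero_squares)
  from double_card_inter[OF this] show ?thesis by simp
qed

end

text \<open>
  \<open>w\<close> stands for \<open>\<chi>\<^sub>4 (1 + x \<omega>\<^sup>l)\<close> divided by \<open>\<i>\<^sup>h\<close>, and \<open>\<sigma> = \<epsilon> \<delta>\<close>.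
\<close>
locale quarter_counting = quadratic_extension q K for q and K :: "'a :: finite_field set" +
  fixes w :: "'a \<Rightarrow> complex" and m \<sigma> :: int
  assumes w_values: "\<And>x. x \<in> K \<Longrightarrow> w x \<in> {1, \<i>, - 1, - \<i>}"
    and sigma: "\<sigma> \<in> {1, - 1}"
    and q_eq: "int q = 2 * m\<^sup>2 + 2 * m + 1"
    and m_neq: "m \<noteq> 0" "m \<noteq> - 2"
    and sum_w: "(\<Sum>x\<in>K. w x) = - (of_int (\<sigma> * (m + 1)) + of_int m * \<i>)"
    and sum_w_eta: "\<And>s. s \<in> K \<Longrightarrow> (\<Sum>x\<in>K. w x * \<eta> (x - s)) =
      \<i> * cnj (w s) * (of_int (\<sigma> * (m + 1)) + of_int m * \<i>) + \<i>"
    and sum_w_square: "(\<Sum>x\<in>K. (w x)\<^sup>2) = 1"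
    and sum_eta_0: "\<And>s. s \<in> K \<Longrightarrow> (\<Sum>x\<in>K. \<eta> (x - s)) = 0"
begin

definition u :: "'a \<Rightarrow> real" where "u x = Re (w x)"
definition v :: "'a \<Rightarrow> real" where "v x = Im (w x)"
definition e :: "'a \<Rightarrow> real" where "e x = Re (\<eta> x)"

text \<open>After division by \<open>\<i> powi h\<close>, the set \<open>A\<close> collects the
  quartic classes \<open>h\<close> and \<open>h + 1\<close>, and \<open>B\<close> the classes
  \<open>h + 1\<close> and \<open>h + 2\<close>.\<close>

definition A :: "'a set" where "A = {x \<in> K. w x \<in> {1, \<i>}}"
definition B :: "'a set" where "B = {x \<in> K. w x \<in> {\<i>, - 1}}"

lemma uv_cases:
  assumes "x \<in> K"
  obtains "u x = 1" "v x = 0" | "u x = 0" "v x = 1" | "u x = -1" "v x = 0" | "u x = 0" "v x = -1"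
  using w_values[OF assms] by (auto simp: u_def v_def)

lemma indicator_A: "x \<in> K \<Longrightarrow> of_bool (x \<in> A) = (1 + u x + v x) / 2"
  using w_values[of x] by (auto simp: u_def v_def A_def complex_eq_iff)

lemma indicator_B: "x \<in> K \<Longrightarrow> of_bool (x \<in> B) = (1 - u x + v x) / 2"
  using w_values[of x] by (auto simp: u_def v_def B_def complex_eq_iff)

lemma real_q: "real q = 2 * m\<^sup>2 + 2 * m + 1"
  using arg_cong[OF q_eq, of real_of_int] by simp

lemma sum_u: "(\<Sum>x\<in>K. u x) = - (\<sigma> * (m + 1))"
  using arg_cong[OF sum_w, of Re] by (simp add: u_def)

lemma sum_v: "(\<Sum>x\<in>K. v x) = - m"
  using arg_cong[OF sum_w, of Im] by (simp add: v_def)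

lemma Im_eta: "Im (\<eta> x) = 0"
  by (simp add: quadratic_character_def)

lemma sum_u_e: "s \<in> K \<Longrightarrow> (\<Sum>x\<in>K. u x * e (x - s)) = v s * (\<sigma> * (m + 1)) - u s * m"
  using arg_cong[OF sum_w_eta, of s Re] by (simp add: u_def v_def e_def Im_eta algebra_simps)

lemma sum_v_e: "s \<in> K \<Longrightarrow> (\<Sum>x\<in>K. v x * e (x - s)) = u s * (\<sigma> * (m + 1)) + v s * m + 1"
  using arg_cong[OF sum_w_eta, of s Im] by (simp add: u_def v_def e_def Im_eta algebra_simps)

lemma sum_e: "s \<in> K \<Longrightarrow> (\<Sum>x\<in>K. e (x - s)) = 0"
  using arg_cong[OF sum_eta_0, of s Re] by (simp add: e_def)

text \<open>The two sums add up to \<open>q\<close> because \<open>w\<close> has modulus 1, and they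
  differ by the real part of the sum of the squares of \<open>w\<close>.\<close>

lemma sum_u_square: "(\<Sum>x\<in>K. (u x)\<^sup>2) = m\<^sup>2 + m + 1"
  and sum_v_square: "(\<Sum>x\<in>K. (v x)\<^sup>2) = m\<^sup>2 + m"
proof -
  have "(\<Sum>x\<in>K. (u x)\<^sup>2 + (v x)\<^sup>2) = (\<Sum>x\<in>K. 1)"
    by (intro sum.cong refl) (elim uv_cases, auto)
  hence "(\<Sum>x\<in>K. (u x)\<^sup>2) + (\<Sum>x\<in>K. (v x)\<^sup>2) = 2 * m\<^sup>2 + 2 * m + 1"
    using real_q by (simp add: sum.distrib card_K)
  moreover have "(\<Sum>x\<in>K. (u x)\<^sup>2) - (\<Sum>x\<in>K. (v x)\<^sup>2) = 1"
    using arg_cong[OF sum_w_square, of Re] by (simp add: u_def v_def Re_power2 sum_subtractf)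
  ultimately show "(\<Sum>x\<in>K. (u x)\<^sup>2) = m\<^sup>2 + m + 1" "(\<Sum>x\<in>K. (v x)\<^sup>2) = m\<^sup>2 + m"
    by linarith+
qed

text \<open>If the value \<open>r\<close> were missed, \<open>u\<close> would only take the values 0
  and \<open>- r\<close>, so \<open>u^2 + r * u\<close> would vanish termwise; yet its sum is
  \<open>m^2\<close> or \<open>(m + 1)^2 + 1\<close>. Together with \<open>ex_v\<close>, all four
  values of \<open>w\<close> occur, hence every listed intersection size is attained.\<close>

lemma ex_u:
  assumes "r \<in> {1, - 1 :: int}" shows "\<exists>x\<in>K. u x = r \<and> v x = 0"
proof (rule ccontr)
  assume no: "\<not> ?thesis"
  have "(\<Sum>x\<in>K. (u x)\<^sup>2 + r * u x) = 0"
  proof (intro sum.neutral ballI)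
    fix x assume "x \<in> K"
    thus "(u x)\<^sup>2 + r * u x = 0"
      by (cases rule: uv_cases) (use no assms \<open>x \<in> K\<close> in auto)
  qed
  hence "real_of_int (m\<^sup>2 + m + 1 - r * \<sigma> * (m + 1)) = 0"
    using sum_u sum_u_square by (simp add: sum.distrib flip: sum_distrib_left)
  hence *: "m\<^sup>2 + m + 1 - r * \<sigma> * (m + 1) = 0" by (simp only: of_int_eq_0_iff)
  from assms sigma consider "r * \<sigma> = 1" | "r * \<sigma> = -1" by auto
  thus False
  proof cases
    case 1 thus False using * m_neq by simp
  next
    case 2
    hence "(m + 1)\<^sup>2 + 1 = 0" using * by (simp add: power2_eq_square algebra_simps)
    thus False using zero_le_power2[of "m + 1"] by linarith
  qed
qed

lemma ex_v:
  assumes "r \<in> {1, - 1 :: int}" shows "\<exists>x\<in>K. v x = r \<and> u x = 0"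
proof (rule ccontr)
  assume no: "\<not> ?thesis"
  have "(\<Sum>x\<in>K. (v x)\<^sup>2 + r * v x) = 0"
  proof (intro sum.neutral ballI)
    fix x assume "x \<in> K"
    thus "(v x)\<^sup>2 + r * v x = 0"
      by (cases rule: uv_cases) (use no assms \<open>x \<in> K\<close> in auto)
  qed
  hence "real_of_int (m\<^sup>2 + m - r * m) = 0"
    using sum_v sum_v_square by (simp add: sum.distrib flip: sum_distrib_left)
  \<comment> \<open>The factor is \<open>m\<close> for \<open>r = 1\<close> and \<open>m + 2\<close>
    for \<open>r = -1\<close>; this is where \<open>m = - 2\<close> has to be excluded.\<close>
  hence "m * (m + 1 - r) = 0" by (simp only: of_int_eq_0_iff) (simp add: power2_eq_square algebra_simps)
  thus False using m_neq assms by auto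
qed

lemma card_eq_sum_of_bool: "X \<subseteq> K \<Longrightarrow> real (card X) = (\<Sum>x\<in>K. of_bool (x \<in> X))"
  by (simp add: of_bool_def sum.If_cases Int_absorb1 Collect_mem_eq)

lemma sum_subset_eq: "X \<subseteq> K \<Longrightarrow> (\<Sum>x\<in>X. f x) = (\<Sum>x\<in>K. of_bool (x \<in> X) * f x)"
  for f :: "'a \<Rightarrow> real"
  by (simp add: of_bool_def if_distrib[of "\<lambda>y. y * _"] sum.If_cases Int_absorb1 Collect_mem_eq cong: if_cong)

lemma A_subset: "A \<subseteq> K" and B_subset: "B \<subseteq> K"
  by (auto simp: A_def B_def)

lemma card_A: "2 * real (card A) = real q - \<sigma> * (m + 1) - m"
proof -
  have "real (card A) = (\<Sum>x\<in>K. (1 + u x + v x) / 2)"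
    using A_subset by (simp add: card_eq_sum_of_bool indicator_A del: sum_of_bool_eq)
  thus ?thesis by (simp add: sum.distrib sum_u sum_v card_K flip: sum_divide_distrib)
qed

lemma card_B: "2 * real (card B) = real q + \<sigma> * (m + 1) - m"
proof -
  have "real (card B) = (\<Sum>x\<in>K. (1 - u x + v x) / 2)"
    using B_subset by (simp add: card_eq_sum_of_bool indicator_B del: sum_of_bool_eq)
  thus ?thesis by (simp add: sum.distrib sum_subtractf sum_u sum_v card_K flip: sum_divide_distrib)
qed

lemma sum_e_A:
  assumes "s \<in> K"
  shows "2 * (\<Sum>x\<in>A. e (x - s)) = (\<Sum>x\<in>K. u x * e (x - s)) + (\<Sum>x\<in>K. v x * e (x - s))"
proof -
  have "2 * (\<Sum>x\<in>A. e (x - s)) = (\<Sum>x\<in>K. e (x - s) + u x * e (x - s) + v x * e (x - s))"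
    unfolding sum_subset_eq[OF A_subset] sum_distrib_left
    by (intro sum.cong refl) (simp add: indicator_A field_simps)
  thus ?thesis using assms by (simp add: sum.distrib sum_e)
qed

lemma sum_e_B:
  assumes "s \<in> K"
  shows "2 * (\<Sum>x\<in>B. e (x - s)) = (\<Sum>x\<in>K. v x * e (x - s)) - (\<Sum>x\<in>K. u x * e (x - s))"
proof -
  have "2 * (\<Sum>x\<in>B. e (x - s)) = (\<Sum>x\<in>K. e (x - s) - u x * e (x - s) + v x * e (x - s))"
    unfolding sum_subset_eq[OF B_subset] sum_distrib_left
    by (intro sum.cong refl) (simp add: indicator_B field_simps)
  thus ?thesis using assms by (simp add: sum.distrib sum_subtractf sum_e)
qed

text \<open>Exchanging \<open>A\<close> and \<open>B\<close> amounts to replacing \<open>u\<close>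
  by \<open>- u\<close>, so the choice compensates the sign \<open>\<sigma>\<close> and both
  cardinalities become independent of it.\<close>

definition X0 :: "'a set" where "X0 = (if \<sigma> = 1 then A else B)"
definition X1 :: "'a set" where "X1 = (if \<sigma> = 1 then B else A)"

lemma X_subset: "X0 \<subseteq> K" "X1 \<subseteq> K"
  using A_subset B_subset by (auto simp: X0_def X1_def)

lemma card_X0: "int (card X0) = m\<^sup>2"
  and card_X1: "int (card X1) = m\<^sup>2 + m + 1"
proof -
  have "2 * real (card X0) = 2 * m\<^sup>2" "2 * real (card X1) = 2 * (m\<^sup>2 + m + 1)"
    using card_A card_B sigma real_q by (auto simp: X0_def X1_def)
  hence "real_of_int (int (card X0)) = real_of_int (m\<^sup>2)"
    "real_of_int (int (card X1)) = real_of_int (m\<^sup>2 + m + 1)" by simp_all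
  thus "int (card X0) = m\<^sup>2" "int (card X1) = m\<^sup>2 + m + 1" by (simp_all only: of_int_eq_iff)
qed

definition N1 :: "'a \<Rightarrow> int" where
  "N1 s = int (card (X0 \<inter> translate (nonzero_squares K \<union> {0}) s)
    + card (X1 \<inter> translate (nonzero_squares K) s))"

definition N2 :: "'a \<Rightarrow> int" where
  "N2 s = int (card (X0 \<inter> translate (nonzero_squares K) s)
    + card (X1 \<inter> translate ((K - {0}) - nonzero_squares K) s))"

text \<open>Both intersections carry \<open>e\<close> with a plus sign, so the \<open>u\<close>
  terms of the indicators cancel and only \<open>sum_v_e\<close> enters. The point \<open>s\<close>
  is gained on \<open>X0\<close> and lost on \<open>X1\<close>, which contributes
  \<open>\<sigma> * u s\<close>.\<close>

lemma N1_eq: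
  assumes "s \<in> K"
  shows "2 * real_of_int (N1 s) = 2 * m\<^sup>2 + m + 2 + \<sigma> * u s * (m + 2) + v s * m"
proof -
  have "2 * real_of_int (N1 s) = real (card X0) + real (card X1)
    + ((\<Sum>x\<in>X0. e (x - s)) + (\<Sum>x\<in>X1. e (x - s))) + (of_bool (s \<in> X0) - of_bool (s \<in> X1))"
    unfolding N1_def e_def of_nat_add of_int_add of_int_of_nat_eq distrib_left
      double_card_inter_squares double_card_inter_squares_0 by simp
  also have "real (card X0) + real (card X1) = 2 * m\<^sup>2 + m + 1"
    using arg_cong[OF card_X0, of real_of_int] arg_cong[OF card_X1, of real_of_int] by simp
  also have "(\<Sum>x\<in>X0. e (x - s)) + (\<Sum>x\<in>X1. e (x - s)) = (\<Sum>x\<in>K. v x * e (x - s))"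
    using sum_e_A[OF assms] sum_e_B[OF assms] by (auto simp: X0_def X1_def)
  also have "\<dots> = u s * (\<sigma> * (m + 1)) + v s * m + 1" by (rule sum_v_e[OF assms])
  also have "of_bool (s \<in> X0) - of_bool (s \<in> X1) = \<sigma> * u s"
    using sigma by (auto simp: X0_def X1_def indicator_A indicator_B assms field_simps simp del: of_bool_eq_iff)
  finally show ?thesis by (simp add: algebra_simps)
qed

text \<open>Squares against nonsquares give \<open>e\<close> opposite signs, which leaves only
  \<open>sum_u_e\<close>. The point \<open>s\<close> is lost on both sets, which contributes
  \<open>- (1 + v s)\<close>.\<close>

lemma N2_eq:
  assumes "s \<in> K"
  shows "2 * real_of_int (N2 s) = 2 * m\<^sup>2 + m + v s * m - \<sigma> * u s * m"
proof -
  have "2 * real_of_int (N2 s) = real (card X0) + real (card X1)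
    + ((\<Sum>x\<in>X0. e (x - s)) - (\<Sum>x\<in>X1. e (x - s))) - (of_bool (s \<in> X0) + of_bool (s \<in> X1))"
    unfolding N2_def e_def of_nat_add of_int_add of_int_of_nat_eq distrib_left
      double_card_inter_squares double_card_inter_nonsquares[OF X_subset(2) assms] by simp
  also have "real (card X0) + real (card X1) = 2 * m\<^sup>2 + m + 1"
    using arg_cong[OF card_X0, of real_of_int] arg_cong[OF card_X1, of real_of_int] by simp
  also have "(\<Sum>x\<in>X0. e (x - s)) - (\<Sum>x\<in>X1. e (x - s)) = \<sigma> * (\<Sum>x\<in>K. u x * e (x - s))"
    using sum_e_A[OF assms] sum_e_B[OF assms] sigma by (auto simp: X0_def X1_def)
  also have "\<dots> = \<sigma> * (v s * (\<sigma> * (m + 1)) - u s * m)" by (simp only: sum_u_e[OF assms])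
  also have "\<dots> = v s * (m + 1) - \<sigma> * u s * m"
    using sigma by (auto simp: algebra_simps)
  also have "of_bool (s \<in> X0) + of_bool (s \<in> X1) = 1 + v s"
    by (auto simp: X0_def X1_def indicator_A indicator_B assms field_simps simp del: of_bool_eq_iff)
  finally show ?thesis by (simp add: algebra_simps)
qed

lemma N_values:
  assumes "s \<in> K"
  shows "u s = \<sigma> \<Longrightarrow> v s = 0 \<Longrightarrow> N1 s = m\<^sup>2 + m + 2 \<and> N2 s = m\<^sup>2"
    and "u s = 0 \<Longrightarrow> v s = 1 \<Longrightarrow> N1 s = m\<^sup>2 + m + 1 \<and> N2 s = m\<^sup>2 + m"
    and "u s = - \<sigma> \<Longrightarrow> v s = 0 \<Longrightarrow> N1 s = m\<^sup>2 \<and> N2 s = m\<^sup>2 + m"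
    and "u s = 0 \<Longrightarrow> v s = -1 \<Longrightarrow> N1 s = m\<^sup>2 + 1 \<and> N2 s = m\<^sup>2"
proof -
  have sq: "real_of_int \<sigma> * real_of_int \<sigma> = 1" using sigma by auto
  note N = N1_eq[OF assms] N2_eq[OF assms]
  have int_eq: "a = c" if "2 * real_of_int a = 2 * real_of_int c" for a c using that by simp
  show "u s = \<sigma> \<Longrightarrow> v s = 0 \<Longrightarrow> N1 s = m\<^sup>2 + m + 2 \<and> N2 s = m\<^sup>2"
    by (intro conjI int_eq; simp add: N sq)
  show "u s = 0 \<Longrightarrow> v s = 1 \<Longrightarrow> N1 s = m\<^sup>2 + m + 1 \<and> N2 s = m\<^sup>2 + m"
    by (intro conjI int_eq; simp add: N)
  show "u s = - \<sigma> \<Longrightarrow> v s = 0 \<Longrightarrow> N1 s = m\<^sup>2 \<and> N2 s = m\<^sup>2 + m"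
    by (intro conjI int_eq; simp add: N sq)
  show "u s = 0 \<Longrightarrow> v s = -1 \<Longrightarrow> N1 s = m\<^sup>2 + 1 \<and> N2 s = m\<^sup>2"
    by (intro conjI int_eq; simp add: N)
qed

lemma N1_image: "N1 ` K = {m\<^sup>2, m\<^sup>2 + 1, m\<^sup>2 + m + 1, m\<^sup>2 + m + 2}"
  and N2_image: "N2 ` K = {m\<^sup>2, m\<^sup>2 + m}"
proof -
  have sigma': "- \<sigma> \<in> {1, - 1}" using sigma by auto
  obtain s0 where s0: "s0 \<in> K" "u s0 = \<sigma>" "v s0 = 0" using ex_u[OF sigma] by blast
  obtain s2 where s2: "s2 \<in> K" "u s2 = - \<sigma>" "v s2 = 0" using ex_u[OF sigma'] by auto
  obtain s1 where s1: "s1 \<in> K" "u s1 = 0" "v s1 = 1" using ex_v[of 1] by auto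
  obtain s3 where s3: "s3 \<in> K" "u s3 = 0" "v s3 = -1" using ex_v[of "-1"] by auto
  note vals = N_values(1)[OF s0] N_values(2)[OF s1] N_values(3)[OF s2] N_values(4)[OF s3]
  have all: "(N1 s, N2 s) \<in> {(m\<^sup>2 + m + 2, m\<^sup>2), (m\<^sup>2 + m + 1, m\<^sup>2 + m), (m\<^sup>2, m\<^sup>2 + m), (m\<^sup>2 + 1, m\<^sup>2)}"
    if "s \<in> K" for s
  proof -
    from that sigma consider "u s = \<sigma>" "v s = 0" | "u s = 0" "v s = 1" | "u s = - \<sigma>" "v s = 0"
      | "u s = 0" "v s = -1" by (cases rule: uv_cases[of s]) auto
    thus ?thesis using N_values[OF that] by cases auto
  qed
  show "N1 ` K = {m\<^sup>2, m\<^sup>2 + 1, m\<^sup>2 + m + 1, m\<^sup>2 + m + 2}"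
  proof (intro equalityI subsetI)
    fix y assume "y \<in> {m\<^sup>2, m\<^sup>2 + 1, m\<^sup>2 + m + 1, m\<^sup>2 + m + 2}"
    hence "y \<in> {N1 s2, N1 s3, N1 s1, N1 s0}" using vals by simp
    thus "y \<in> N1 ` K" using s0(1) s1(1) s2(1) s3(1) by blast
  qed (use all in fastforce)
  show "N2 ` K = {m\<^sup>2, m\<^sup>2 + m}"
  proof (intro equalityI subsetI)
    fix y assume "y \<in> {m\<^sup>2, m\<^sup>2 + m}"
    hence "y \<in> {N2 s0, N2 s1}" using vals by simp
    thus "y \<in> N2 ` K" using s0(1) s1(1) by blast
  qed (use all in fastforce)
qed

end

section \<open>Cyclotomic classes as fibres of the character, and the final assembly\<close>

lemma imaginary_unit_powi_eq_1_imp: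
  assumes "\<i> powi k = 1" shows "4 dvd k"
proof -
  have "\<i> ^ nat \<bar>k\<bar> = \<i> ^ 0"
    using assms by (cases "k \<ge> 0")
      (auto simp: power_int_def power_inverse simp del: inverse_i)
  hence "nat \<bar>k\<bar> mod 4 = 0" by (subst (asm) imaginary_unit_power_eq_iff) simp
  hence "int (nat \<bar>k\<bar>) mod int 4 = 0" unfolding zmod_int[symmetric] by simp
  hence "int 4 dvd int (nat \<bar>k\<bar>)" by (simp only: mod_eq_0_iff_dvd)
  thus ?thesis by simp
qed

context quartic_character
begin

text \<open>Equal values of \<open>\<chi>\<close> force exponents of \<open>\<omega>\<close> to
  agree modulo 4, so the quartic classes are exactly the fibres of \<open>\<chi>\<close> on nonzero
  elements.\<close>

lemma mem_cyclotomic_class: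
  assumes "y \<noteq> 0"
  shows "y \<in> cyclotomic_class \<omega> 4 j \<longleftrightarrow> \<chi> y = \<i> powi j"
proof
  assume "y \<in> cyclotomic_class \<omega> 4 j"
  then obtain k where k: "y = \<omega> powi j * (\<omega> ^ 4) powi k" by (auto simp: cyclotomic_class_def)
  have "\<i> ^ 4 = 1" by (simp add: power4_eq_xxxx)
  thus "\<chi> y = \<i> powi j"
    unfolding k by (simp add: chi_mult chi_powi chi_power chi_omega)
next
  assume chi: "\<chi> y = \<i> powi j"
  obtain n where n: "y = \<omega> ^ n" using omega_power_ex assms by blast
  have "\<i> powi (int n - j) = 1"
    using chi by (simp add: n chi_omega_power power_int_diff)
  hence "4 dvd int n - j" by (rule imaginary_unit_powi_eq_1_imp)
  then obtain k where k: "int n - j = 4 * k" by auto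
  have "y = \<omega> powi (j + 4 * k)" by (simp add: n flip: k)
  also have "\<dots> = \<omega> powi j * (\<omega> ^ 4) powi k"
    by (simp add: power_int_add power_int_mult)
  finally show "y \<in> cyclotomic_class \<omega> 4 j" unfolding cyclotomic_class_def by blast
qed

lemma omega_powi_mem_K_imp:
  assumes "\<omega> powi l \<in> K" shows "int q + 1 dvd l"
proof -
  have "\<omega> ^ nat \<bar>l\<bar> \<in> K"
  proof (cases "l \<ge> 0")
    case True
    thus ?thesis using assms by (simp add: power_int_def)
  next
    case False
    hence "\<omega> ^ nat \<bar>l\<bar> = inverse (\<omega> powi l)" by (simp add: power_int_def power_inverse)
    thus ?thesis using assms by simp
  qed
  hence "q + 1 dvd nat \<bar>l\<bar>" by (simp only: omega_power_mem_K)
  hence "int (q + 1) dvd \<bar>l\<bar>" by (subst (asm) int_dvd_int_iff[symmetric]) simp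
  thus ?thesis by (simp add: add.commute)
qed

end

theorem theorem5p6:
  fixes m :: int and q :: nat
    and Fq :: "'a :: finite_field set"
    and \<omega> :: 'a and \<chi>\<^sub>4 :: "'a \<Rightarrow> complex"
    and \<epsilon> \<delta> h l :: int
    and H\<^sub>0 H\<^sub>1 :: "int set"
  assumes "even m" and "m \<noteq> - 2"
    and "int q = 2 * m\<^sup>2 + 2 * m + 1" and "primepow q"
    and "card (UNIV :: 'a set) = q\<^sup>2"
    and "is_subfield Fq" and "card Fq = q"
    and "primitive_element \<omega>"
    and "is_mult_character UNIV \<chi>\<^sub>4" and "\<chi>\<^sub>4 \<omega> = \<i>"
    and "\<epsilon> \<in> {1, - 1}" and "\<delta> \<in> {1, - 1}"
    and "gauss_sum Fq (quadratic_character Fq) * gauss_sum UNIV \<chi>\<^sub>4 / of_nat q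
           = of_int (\<epsilon> * (m + 1)) + of_int (\<delta> * m) * \<i>"
    and "h \<in> {0, 1, 2, 3}"
    and "\<not> (int q + 1) dvd l"
    and "\<chi>\<^sub>4 (\<omega> powi l) = \<i> powi (3 + h)"
    and "\<chi>\<^sub>4 (\<omega> powi (l * int q) - \<omega> powi l) = \<i> powi (\<delta> * (1 + 2 * h))"
    and "(H\<^sub>0, H\<^sub>1) = (if \<epsilon> * \<delta> = 1 then ({h, h + 1}, {h + 1, h + 2})
                                   else ({h + 1, h + 2}, {h, h + 1}))"
  shows "int (card (D_set Fq \<omega> l H\<^sub>0)) = m\<^sup>2 \<and>
    int (card (D_set Fq \<omega> l H\<^sub>1)) = m\<^sup>2 + m + 1 \<and>
    {int (card (D_set Fq \<omega> l H\<^sub>0 \<inter> translate (nonzero_squares Fq \<union> {0}) s)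
          + card (D_set Fq \<omega> l H\<^sub>1 \<inter> translate (nonzero_squares Fq) s)) | s. s \<in> Fq}
      = {m\<^sup>2, m\<^sup>2 + 1, m\<^sup>2 + m + 1, m\<^sup>2 + m + 2} \<and>
    {int (card (D_set Fq \<omega> l H\<^sub>0 \<inter> translate (nonzero_squares Fq) s)
          + card (D_set Fq \<omega> l H\<^sub>1 \<inter> translate ((Fq - {0}) - nonzero_squares Fq) s)) | s. s \<in> Fq}
      = {m\<^sup>2, m\<^sup>2 + m}"
proof -
  note m_even = assms(1) and m2 = assms(2) and qm = assms(3)
  define b where "b = \<omega> powi l"
  \<comment> \<open>Evenness gives the congruence modulo 4, since
    \<open>q - 1 = 2 * (m * (m + 1))\<close>.\<close>
  have "even (m * (m + 1))" using m_even by simp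
  then obtain k where "m * (m + 1) = 2 * k" by blast
  hence "int q = 4 * k + 1" using qm by (simp add: power2_eq_square algebra_simps)
  hence q4: "q mod 4 = 1" by presburger
  interpret quadratic_extension q Fq
    by unfold_locales (use assms in auto)
  interpret quartic_character q Fq \<omega> \<chi>\<^sub>4
    by unfold_locales (use assms q4 in auto)
  interpret quartic_character_line q Fq \<omega> \<chi>\<^sub>4 b
    by unfold_locales (use omega_powi_mem_K_imp[of l] assms(15) b_def in auto)
  define \<sigma> where "\<sigma> = \<epsilon> * \<delta>"
  \<comment> \<open>Dividing by \<open>\<i> powi h\<close> rotates the classes so that
    \<open>h\<close> disappears from the counting; \<open>E\<close> is the Eisenstein sum with a
    factor \<open>\<delta>\<close> taken out.\<close>
  define w where "w x = \<chi>\<^sub>4 (1 + x * b) / \<i> powi h" for x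
  define E where "E = of_int (\<sigma> * (m + 1)) + of_int m * \<i>"
  have m0: "m \<noteq> 0" using q_gt_1 qm by auto
  have dd: "of_int \<delta> * of_int \<delta> = (1 :: complex)" using assms(12) by auto
  have eis: "eisenstein = of_int \<delta> * E"
  proof -
    have "eisenstein = of_int (\<epsilon> * (m + 1)) + of_int (\<delta> * m) * \<i>"
      using assms(13) by (simp add: eisenstein_def)
    also have "\<dots> = of_int \<delta> * E"
      using assms(12) by (auto simp: E_def \<sigma>_def algebra_simps)
    finally show ?thesis .
  qed
  have eis0: "eisenstein \<noteq> 0"
    unfolding eis using assms(12) m0 by (auto simp: E_def complex_eq_iff)
  have chi_b: "\<chi>\<^sub>4 b = \<i> powi (3 + h)" using assms(16) by (simp add: b_def)
  have chi_D: "\<chi>\<^sub>4 (b ^ q - b) = \<i> powi (\<delta> * (1 + 2 * h))"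
    using assms(17) by (simp add: b_def power_int_mult)
  have ipow: "\<i> powi (3 + h) / \<i> powi h = - \<i>"
    by (simp add: power_int_add power3_eq_cube)
  \<comment> \<open>The two conditions on \<open>l\<close> are made for this: the exponents are -2
    and 1 for \<open>\<delta> = 1\<close>, and \<open>-4 - 4 * h\<close> and
    \<open>-1 - 4 * h\<close> for \<open>\<delta> = -1\<close>, so \<open>h\<close> drops out modulo
    4. The remaining \<open>\<delta>\<close> cancels the one in \<open>eis\<close>.\<close>
  have ipow1: "\<i> powi (\<delta> * (1 + 2 * h)) / \<i> powi (3 + h) / \<i> powi h = - of_int \<delta>"
    and ipow2: "\<i> powi (\<delta> * (1 + 2 * h)) / (\<i> powi h * \<i> powi h) = of_int \<delta> * \<i>"
    and ipow3: "(\<i> powi (3 + h) / \<i> powi h)\<^sup>2 = - 1"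
    using assms(12,14) by (auto simp: power_int_def eval_nat_numeral field_simps)
  have w_values: "w x \<in> {1, \<i>, - 1, - \<i>}" if x: "x \<in> Fq" for x
  proof -
    obtain n where n: "1 + x * b = \<omega> ^ n" using omega_power_ex line_nonzero[OF x] by blast
    have "w x = \<i> powi (int n - h)"
      by (simp add: w_def n chi_omega_power power_int_diff)
    also have "\<dots> = \<i> powi ((int n - h) mod 4 + 4 * ((int n - h) div 4))" by simp
    also have "\<dots> = \<i> powi ((int n - h) mod 4)"
      by (subst power_int_add) (simp_all only: power_int_mult, simp_all add: power4_eq_xxxx)
    finally have "w x = \<i> powi ((int n - h) mod 4)" .
    moreover have "(int n - h) mod 4 \<in> {0, 1, 2, 3}" by auto
    ultimately show ?thesis by (auto simp: power3_eq_cube)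
  qed
  have w_cnj: "1 / w x = cnj (w x)" if "x \<in> Fq" for x
    using w_values[OF that] by auto
  have sum_w: "(\<Sum>x\<in>Fq. w x) = - E"
  proof -
    have "(\<Sum>x\<in>Fq. w x) = \<i> powi (\<delta> * (1 + 2 * h)) / \<i> powi (3 + h) / \<i> powi h * eisenstein"
      by (simp add: w_def sum_chi_line[OF eis0] chi_b chi_D flip: sum_divide_distrib)
    thus ?thesis unfolding ipow1 eis using dd by (simp add: mult.assoc[symmetric])
  qed
  have sum_w_eta: "(\<Sum>x\<in>Fq. w x * \<eta> (x - s)) = \<i> * cnj (w s) * E + \<i>" if s: "s \<in> Fq" for s
  proof -
    have "(\<Sum>x\<in>Fq. w x * \<eta> (x - s)) = (\<Sum>x\<in>Fq. \<chi>\<^sub>4 (1 + x * b) * \<eta> (x - s)) / \<i> powi h"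
      by (simp add: w_def sum_divide_distrib)
    also have "\<dots> = \<i> powi (\<delta> * (1 + 2 * h)) / (\<i> powi h * \<i> powi h) * eisenstein * (1 / w s)
        - \<i> powi (3 + h) / \<i> powi h"
      unfolding sum_chi_eta_line[OF eis0 s] chi_b chi_D w_def by (simp add: field_simps)
    also have "\<dots> = (of_int \<delta> * of_int \<delta>) * \<i> * E * cnj (w s) + \<i>"
      unfolding ipow ipow2 w_cnj[OF s] eis by (simp add: mult_ac)
    finally show ?thesis by (simp only: dd) (simp add: mult_ac)
  qed
  have sum_w_square: "(\<Sum>x\<in>Fq. (w x)\<^sup>2) = 1"
    using sum_chi_square_line ipow3
    by (simp add: w_def power_divide chi_b flip: sum_divide_distrib)
  interpret quarter_counting q Fq w m \<sigma>
  proof unfold_locales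
    show "\<sigma> \<in> {1, - 1}" using assms(11,12) by (auto simp: \<sigma>_def)
    show "(\<Sum>x\<in>Fq. \<eta> (x - s)) = 0" if "s \<in> Fq" for s using sum_eta_shift[OF that] .
  qed (use w_values qm m0 m2 sum_w sum_w_eta sum_w_square E_def in auto)
  have D_eq: "D_set Fq \<omega> l {j, j + 1} = {x \<in> Fq. \<chi>\<^sub>4 (1 + x * b) \<in> {\<i> powi j, \<i> powi j * \<i>}}" for j
    using line_nonzero mem_cyclotomic_class unfolding D_set_def b_def[symmetric]
    by (auto simp: power_int_add)
  have DA: "D_set Fq \<omega> l {h, h + 1} = A"
    unfolding D_eq A_def w_def by (auto simp: field_simps)
  have DB: "D_set Fq \<omega> l {h + 1, h + 2} = B"
    using D_eq[of "h + 1"] unfolding B_def w_def by (auto simp: field_simps power_int_add)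
  have X: "D_set Fq \<omega> l H\<^sub>0 = X0" "D_set Fq \<omega> l H\<^sub>1 = X1"
    using assms(18)[folded \<sigma>_def] by (auto simp: X0_def X1_def DA DB split: if_splits)
  show ?thesis
    using card_X0 card_X1 N1_image N2_image unfolding X N1_def N2_def
    by (simp only: Setcompr_eq_image)
qed

end
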